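(* For every integer $n\ge 1$, $\delta_P(n)=2C(n)-n$.
   Context: $\mathcal{T}_\infty$ is the infinite binary tree with all leaves at the same level: its vertices are the pairs $(i,j)$ of integers with $i\ge 1$, $j\ge 0$; the vertex $(i,j)$ has parent $(i+1,\lfloor j/2\rfloor)$, and the edges join each vertex to its parent. For a finite vertex set $S$, $\overline S$ is its complement and $(S,\overline S)$ is the set of edges with one end in $S$ and the other in $\overline S$. $\delta_P(n)$ is the minimum of $|(S,\overline S)|$ over all $S\subset V(\mathcal{T}_\infty)$ with $|S|=n$ such that $\overline S$ induces a connected subgraph. Conolly sequence: $C(1)=1$, $C(2)=2$ and $C(n)=C(n-C(n-1))+C(n-1-C(n-2))$ for $n>2$. *)

theory Defs
  imports Main
begin

text \<open>
  A simple graph is given by its vertex set \<open>V\<close> and its edge set \<open>E\<close>, whose elements are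
  unordered pairs \<open>{u, v}\<close>.
\<close>

definition edge_boundary :: "'a set \<Rightarrow> 'a set set \<Rightarrow> 'a set \<Rightarrow> 'a set set" where
  "edge_boundary V E S = {e \<in> E. \<exists>u\<in>S. \<exists>v\<in>V - S. e = {u, v}}"

definition induces_connected :: "'a set set \<Rightarrow> 'a set \<Rightarrow> bool" where
  "induces_connected E A \<longleftrightarrow>
     A \<noteq> {} \<and> (\<forall>u\<in>A. \<forall>v\<in>A. (u, v) \<in> {(x, y). x \<in> A \<and> y \<in> A \<and> {x, y} \<in> E}\<^sup>*)"

definition tree_verts :: "(nat \<times> nat) set" where
  "tree_verts = {(i, j). i \<ge> 1}"

definition tree_parent :: "nat \<times> nat \<Rightarrow> nat \<times> nat" where
  "tree_parent = (\<lambda>(i, j). (i + 1, j div 2))"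

definition tree_edges :: "(nat \<times> nat) set set" where
  "tree_edges = {{v, tree_parent v} | v. v \<in> tree_verts}"

text \<open>
  The sets \<open>S\<close> are infinitely many but the boundary sizes are natural numbers, so the
  infimum is a minimum as soon as some admissible \<open>S\<close> exists.
\<close>

definition delta_P :: "nat \<Rightarrow> nat" where
  "delta_P n =
     Inf {card (edge_boundary tree_verts tree_edges S) | S.
            S \<subseteq> tree_verts \<and> finite S \<and> card S = n \<and>
            induces_connected tree_edges (tree_verts - S)}"

text \<open>
  The sequence starts at index 1. The value at 0 is a dummy that makes all values positive,
  which is what termination of the nested recursion needs; \<open>conolly_le\<close> below shows that the
  recursion from a positive index never reaches 0.
\<close>

function conolly :: "nat \<Rightarrow> nat" where
  "conolly n =
     (if n \<le> 1 then 1 else if n = 2 then 2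
      else conolly (n - conolly (n - 1)) + conolly (n - 1 - conolly (n - 2)))"
  by auto

lemma conolly_dom_pos: "conolly_dom n \<Longrightarrow> conolly n > 0"
proof (induction n rule: conolly.pinduct)
  case (1 n)
  then show ?case by (subst conolly.psimps) auto
qed

termination
proof (relation "measure id", goal_cases)
  case (3 n)
  then show ?case using conolly_dom_pos[of "n - 1"] by auto
qed auto

declare conolly.simps [simp del]

lemma conolly_1: "conolly 1 = 1"
  and conolly_2: "conolly 2 = 2"
  and conolly_rec:
    "n > 2 \<Longrightarrow> conolly n = conolly (n - conolly (n - 1)) + conolly (n - 1 - conolly (n - 2))"
  by (subst conolly.simps; simp)+

lemma conolly_pos: "conolly n > 0"
proof (induction n rule: conolly.induct)
  case (1 n)
  then show ?case by (subst conolly.simps) auto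
qed

lemma conolly_step:
  assumes "n \<ge> 1"
  shows "conolly n \<le> n \<and> conolly n \<le> conolly (Suc n) \<and> conolly (Suc n) \<le> Suc (conolly n)"
  using assms
proof (induction n rule: less_induct)
  case (less n)
  have c3: "conolly 3 = 2"
    using conolly_rec[of 3] by (simp add: conolly_1[simplified] conolly_2)
  have c4: "conolly 4 = 3"
    using conolly_rec[of 4] by (simp add: conolly_1[simplified] conolly_2 c3)
  show ?case
  proof (cases "n \<le> 3")
    case True
    with less.prems have "n = 1 \<or> n = 2 \<or> n = 3" by auto
    then show ?thesis using conolly_1 conolly_2 c3 c4 by (auto simp: eval_nat_numeral)
  next
    case False
    define k where "k = n - 3"
    have n: "n = k + 3" and k: "k \<ge> 1" using False by (auto simp: k_def)
    define a where "a m = Suc m - conolly m" for m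
    have IH: "conolly m \<le> m" "conolly m \<le> conolly (Suc m)" "conolly (Suc m) \<le> Suc (conolly m)"
      if "m \<ge> 1" "m < k + 3" for m
      using less.IH[of m] that n by auto
    have cn: "conolly (k+3) \<le> k+3"
      using IH[of "k+2"] by (auto simp: eval_nat_numeral)
    have ak: "a k = k + 1 - conolly k" "a (k+1) = k + 2 - conolly (k+1)"
      "a (k+2) = k + 3 - conolly (k+2)" "a (k+3) = k + 4 - conolly (k+3)"
      unfolding a_def by simp_all
    have d: "k+4-1 = k+3" "k+4-2 = k+2" "k+3-1 = k+2" "k+3-2 = k+1" "k+2-1 = k+1" "k+2-2 = k"
      by simp_all
    have r1: "conolly (k+4) = conolly (a (k+3)) + conolly (a (k+2))"
      using conolly_rec[of "k+4"] unfolding ak d by simp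
    have r2: "conolly (k+3) = conolly (a (k+2)) + conolly (a (k+1))"
      using conolly_rec[of "k+3"] unfolding ak d by simp
    have r3: "conolly (k+2) = conolly (a (k+1)) + conolly (a k)"
      using conolly_rec[of "k+2"] k unfolding ak d by simp
    have astep: "a (Suc m) = a m \<or> a (Suc m) = Suc (a m)" if "m \<ge> 1" "m < k + 3" for m
      using IH[OF that] unfolding a_def by auto
    have apos: "a m \<ge> 1" if "m \<ge> 1" "m < k + 3" for m
      using IH(1)[OF that] unfolding a_def by auto
    have alt: "a m < k + 3" if "m < k + 3" for m
      using conolly_pos[of m] that unfolding a_def by auto
    have s: "a (k+1) = a k \<or> a (k+1) = Suc (a k)" "a (k+2) = a (k+1) \<or> a (k+2) = Suc (a (k+1))"
      "a (k+3) = a (k+2) \<or> a (k+3) = Suc (a (k+2))"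
      using astep[of k] astep[of "k+1"] astep[of "k+2"] k by (auto simp: eval_nat_numeral)
    have p: "a k \<ge> 1" "a (k+1) \<ge> 1" "a (k+2) \<ge> 1" "a k < k+3" "a (k+1) < k+3" "a (k+2) < k+3"
      using apos[of k] apos[of "k+1"] apos[of "k+2"] alt[of k] alt[of "k+1"] alt[of "k+2"] k
      by auto
    note J = IH[OF p(1,4)] IH[OF p(2,5)] IH[OF p(3,6)]
    have eq: "conolly (k+3) = conolly (k+2)" if "a (k+3) = Suc (a (k+2))"
      using that conolly_pos[of "k+2"] IH[of "k+2"] cn unfolding a_def by (auto simp: eval_nat_numeral)
    have "conolly (k+3) \<le> conolly (k+4) \<and> conolly (k+4) \<le> Suc (conolly (k+3))"
      using s J r1 r2 r3 eq by auto
    then show ?thesis using cn n by (auto simp: eval_nat_numeral)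
  qed
qed

lemma conolly_le: "n \<ge> 1 \<Longrightarrow> conolly n \<le> n"
  using conolly_step by blast

end

theory Submission
  imports Defs
begin

text \<open>
  Since \<open>S\<close> is finite, its complement is connected exactly when \<open>S\<close> contains, with each vertex,
  all of its descendants. Counting the edges from \<open>S\<close> to parents, such a set with \<open>n\<close> vertices and
  \<open>l\<close> leaves has \<open>2 l - n\<close> boundary edges, so the number of leaves has to be minimised. The level
  sizes at least halve from one level to the next, so \<open>l\<close> leaves carry at most
  \<open>T l = l + \<lfloor>l/2\<rfloor> + \<lfloor>l/4\<rfloor> + \<dots>\<close> vertices, and every \<open>n \<le> T l\<close> is attained with at most \<open>l\<close>
  leaves. Finally \<open>T (2 q) = 2 q + T q\<close> and \<open>T (2 q + 1) = T (2 q) + 1\<close> show that the least \<open>l\<close>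
  with \<open>n \<le> T l\<close> satisfies the Conolly recursion.
\<close>

section \<open>The Conolly sequence\<close>

text \<open>This is \<open>T\<close> of the overview; in closed form it is 2 m minus the number of
  ones in the binary expansion of m.\<close>

fun forest_size :: "nat \<Rightarrow> nat" where
  "forest_size m = (if m = 0 then 0 else m + forest_size (m div 2))"

declare forest_size.simps [simp del]

lemma forest_size_0 [simp]: "forest_size 0 = 0"
  by (simp add: forest_size.simps)

lemma forest_size_rec: "forest_size m = m + forest_size (m div 2)"
  by (cases "m = 0") (simp_all add: forest_size.simps[of m])

lemma forest_size_double: "forest_size (2 * q) = 2 * q + forest_size q"
  using forest_size_rec[of "2 * q"] by simp

lemma forest_size_double_Suc: "forest_size (Suc (2 * q)) = Suc (2 * q + forest_size q)"
  using forest_size_rec[of "Suc (2 * q)"] by simp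

text \<open>The leading summand grows by one, and the halved argument stays put or grows by one, so
  the rest does not shrink.\<close>

lemma forest_size_less_Suc: "forest_size m < forest_size (Suc m)"
proof (induction m rule: less_induct)
  case (less m)
  have "forest_size (m div 2) \<le> forest_size (Suc m div 2)"
  proof (cases "even m")
    case False
    then have "Suc m div 2 = Suc (m div 2)" "m div 2 < m"
      by (auto elim!: oddE)
    then show ?thesis using less[of "m div 2"] by simp
  qed simp
  then show ?case
    using forest_size_rec[of m] forest_size_rec[of "Suc m"] by simp
qed

lemma strict_mono_forest_size: "strict_mono forest_size"
  by (simp add: strict_mono_Suc_iff forest_size_less_Suc)

lemma forest_size_mono: "m \<le> m' \<Longrightarrow> forest_size m \<le> forest_size m'"
  using strict_mono_forest_size by (simp add: strict_mono_less_eq)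

lemma forest_size_ge: "m \<le> forest_size m"
  using forest_size_rec[of m] by simp

text \<open>The values of \<open>forest_size\<close> cut the positive integers into intervals on
  which \<open>conolly\<close> is constant. Strong induction locates n - 1, n - 2 and both recursion
  arguments in these intervals; the parity of m decides the shape of the interval of n.\<close>

lemma conolly_eqI:
  "\<lbrakk>forest_size m < n; n \<le> forest_size (Suc m)\<rbrakk> \<Longrightarrow> conolly n = Suc m"
proof (induction n arbitrary: m rule: less_induct)
  case (less n)
  have T1: "forest_size 1 = 1" "forest_size 2 = 3"
    using forest_size_double_Suc[of 0] forest_size_double[of 1] by simp_all
  show ?case
  proof (cases "n \<le> 2")
    case True
    have "n = 1 \<or> n = 2" using True less.prems(1) by auto
    moreover have "m < n" using forest_size_ge[of m] less.prems(1) by simp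
    moreover have "m \<noteq> 1" if "n = 1" using \<open>m < n\<close> that by simp
    moreover have "m \<noteq> 0" if "n = 2" using less.prems(2) that T1 by (intro notI) simp
    ultimately show ?thesis using conolly_1 conolly_2 by force
  next
    case False
    then have n: "n > 2" by simp
    have IH: "conolly k = Suc p" if "k < n" "forest_size p < k" "k \<le> forest_size (Suc p)" for k p
      using less.IH that by blast
    show ?thesis
    proof (cases "even m")
      case True
      then obtain q where m: "m = 2 * q" by auto
      \<comment> \<open>For even m the interval is a single point. The recursion arguments are then
        \<open>forest_size q + 1\<close> and \<open>forest_size q\<close>, on the two sides of a
        jump, which gives the odd value (q + 1) + q.\<close>
      have neq: "n = Suc (2 * q + forest_size q)"
        using less.prems forest_size_double[of q] forest_size_double_Suc[of q] m by simp
      then obtain p where q: "q = Suc p"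
        using n by (cases q) auto
      note T = forest_size_double[of q] forest_size_double[of p] forest_size_double_Suc[of p]
        forest_size_less_Suc[of q] forest_size_less_Suc[of p]
      have "conolly (n - 1) = 2 * q"
        using IH[of "n - 1" "Suc (2 * p)"] T neq q by simp
      moreover have "conolly (n - 2) = 2 * q"
        using IH[of "n - 2" "Suc (2 * p)"] T neq q by simp
      moreover have "conolly (Suc (forest_size q)) = Suc q"
        using IH[of "Suc (forest_size q)" q] T neq q by simp
      moreover have "conolly (forest_size q) = q"
        using IH[of "forest_size q" p] T neq q by simp
      ultimately show ?thesis
        using conolly_rec[OF n] neq m by simp
    next
      case False
      then obtain p where m: "m = Suc (2 * p)" by (auto elim: oddE)
      \<comment> \<open>If n - 1 lies in the same interval as n, then \<open>x\<close> is the first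
        recursion argument. The three cases below have none, one or both of n - 1 and n - 2 in that
        interval.\<close>
      define x where "x = n - 2 * Suc p"
      note T = forest_size_double[of "Suc p"] forest_size_double[of p] forest_size_double_Suc[of p]
        forest_size_less_Suc[of p]
      have nx: "n = 2 * Suc p + x" "forest_size p \<le> x" "x \<le> forest_size (Suc p)"
        using less.prems m T unfolding x_def by auto
      consider "x = forest_size p" | "x = Suc (forest_size p)" | "x > Suc (forest_size p)"
        using nx by linarith
      then show ?thesis
      proof cases
        case 1
        \<comment> \<open>p = 0 would give n = 2, a base value.\<close>
        then obtain r where p: "p = Suc r" using n nx by (cases p) auto
        have "conolly (n - 1) = Suc (2 * p)"
          using IH[of "n - 1" "2 * p"] T nx 1 by simp
        moreover have "conolly (n - 2) = 2 * p"
          using IH[of "n - 2" "Suc (2 * r)"] T nx 1 p forest_size_double_Suc[of r]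
            forest_size_less_Suc[of r] by simp
        moreover have "conolly (Suc x) = Suc p"
          using IH[of "Suc x" p] T nx 1 by simp
        ultimately show ?thesis
          using conolly_rec[OF n] nx m by simp
      next
        case 2
        have "conolly (n - 1) = 2 * Suc p"
          using IH[of "n - 1" "Suc (2 * p)"] T nx 2 by simp
        moreover have "conolly (n - 2) = Suc (2 * p)"
          using IH[of "n - 2" "2 * p"] T nx 2 by simp
        moreover have "conolly x = Suc p"
          using IH[of x p] T nx 2 by simp
        ultimately show ?thesis
          using conolly_rec[OF n] nx m by simp
      next
        case 3
        have "conolly (n - 1) = 2 * Suc p"
          using IH[of "n - 1" "Suc (2 * p)"] T nx 3 by simp
        moreover have "conolly (n - 2) = 2 * Suc p"
          using IH[of "n - 2" "Suc (2 * p)"] T nx 3 by simp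
        moreover have "conolly x = Suc p"
          using IH[of x p] T nx 3 by simp
        moreover have "conolly (x - 1) = Suc p"
          using IH[of "x - 1" p] T nx 3 by simp
        ultimately show ?thesis
          using conolly_rec[OF n] nx m by simp
      qed
    qed
  qed
qed

text \<open>By strict monotonicity the interval description makes \<open>conolly n\<close> the least
  k with n \<le> \<open>forest_size k\<close>. This form turns size bounds into leaf bounds.\<close>

lemma conolly_le_iff:
  assumes "n \<ge> 1"
  shows "conolly n \<le> l \<longleftrightarrow> n \<le> forest_size l"
proof -
  define k where "k = (LEAST k. n \<le> forest_size k)"
  have k: "n \<le> forest_size k"
    unfolding k_def by (rule LeastI[of _ n]) (rule forest_size_ge)
  then obtain m where m: "k = Suc m"
    using assms by (cases k) auto
  then have m': "forest_size m < n"
    using not_less_Least[of m "\<lambda>k. n \<le> forest_size k"] unfolding k_def[symmetric] by simp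
  have "conolly n = Suc m"
    using conolly_eqI m' k m by simp
  then show ?thesis
    using forest_size_mono[of "Suc m" l] forest_size_mono[of l m] k m m'
    by (metis le_trans not_less not_less_eq_eq)
qed

section \<open>Descendant-closed vertex sets\<close>

definition descendant_closed :: "(nat \<times> nat) set \<Rightarrow> bool" where
  "descendant_closed S \<longleftrightarrow> (\<forall>v\<in>tree_verts. tree_parent v \<in> S \<longrightarrow> v \<in> S)"

lemma fst_tree_parent [simp]: "fst (tree_parent v) = Suc (fst v)"
  by (simp add: tree_parent_def split: prod.split)

lemma in_tree_verts_iff: "v \<in> tree_verts \<longleftrightarrow> fst v \<ge> 1"
  by (cases v) (simp add: tree_verts_def)

lemma tree_parent_funpow: "(tree_parent ^^ k) (i, j) = (i + k, j div 2 ^ k)"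
  by (induction k) (simp_all add: tree_parent_def div_mult2_eq[symmetric] mult.commute)

text \<open>Supplies a target outside \<open>S\<close> above any given subtree, and shows that the
  complement is nonempty.\<close>

lemma exists_high_vertex:
  assumes "finite S"
  obtains i where "i > h" "(i, 0) \<in> tree_verts - S"
proof -
  obtain b where b: "\<And>x. x \<in> fst ` S \<Longrightarrow> x \<le> b"
    using assms finite_nat_set_iff_bounded_le[of "fst ` S"] by auto
  have "(Suc (h + b), 0) \<notin> S"
    using b[of "Suc (h + b)"] by force
  then show ?thesis
    by (intro that[of "Suc (h + b)"]) (auto simp: in_tree_verts_iff)
qed

text \<open>If v is outside \<open>S\<close> but its parent is inside, a path in the complement from
  v to a vertex higher than the parent must leave the subtree \<open>D\<close> below the parent. The
  only exit is through the root of \<open>D\<close>, which lies in \<open>S\<close>.\<close>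

lemma descendant_closed_if_connected:
  assumes fin: "finite S" and conn: "induces_connected tree_edges (tree_verts - S)"
  shows "descendant_closed S"
  unfolding descendant_closed_def
proof (intro ballI impI, rule ccontr)
  fix v assume v: "v \<in> tree_verts" "tree_parent v \<in> S" "v \<notin> S"
  define A where "A = tree_verts - S"
  define D where "D = {x. \<exists>k. (tree_parent ^^ k) x = tree_parent v}"
  obtain i where i: "i > fst (tree_parent v)" "(i, 0) \<in> A"
    using exists_high_vertex[OF fin] unfolding A_def by metis
  have "(v, (i, 0)) \<in> {(x, y). x \<in> A \<and> y \<in> A \<and> {x, y} \<in> tree_edges}\<^sup>*"
    using conn v i(2) unfolding induces_connected_def A_def by blast
  moreover have "v \<in> D"
    unfolding D_def by (auto intro: exI[of _ 1])
  ultimately have "(i, 0) \<in> D"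
  proof (induction rule: rtrancl_induct)
    case (step x y)
    then have xy: "x \<in> D" "x \<in> A" "{x, y} \<in> tree_edges" by auto
    then obtain k where k: "(tree_parent ^^ k) x = tree_parent v"
      by (auto simp: D_def)
    consider "y = tree_parent x" | "x = tree_parent y"
      using xy(3) by (auto simp: tree_edges_def doubleton_eq_iff)
    then show ?case
    proof cases
      case 1
      have "k \<noteq> 0" using k v xy(2) by (auto simp: A_def intro: ccontr)
      then obtain l where "k = Suc l" by (cases k) auto
      then show ?thesis using k 1 by (auto simp: D_def funpow_swap1)
    next
      case 2
      then have "(tree_parent ^^ Suc k) y = tree_parent v"
        using k by (simp add: funpow_swap1)
      then show ?thesis unfolding D_def by blast
    qed
  qed
  then show False
    using i(1) by (auto simp: D_def tree_parent_funpow dest!: arg_cong[where f = fst])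
qed

text \<open>The complement is closed under parents, so each of its vertices climbs within it to the
  spine of vertices (N, 0), where any two such climbs meet.\<close>

lemma connected_if_descendant_closed:
  assumes fin: "finite S" and closed: "descendant_closed S"
  shows "induces_connected tree_edges (tree_verts - S)"
proof -
  define A where "A = tree_verts - S"
  define R where "R = {(x, y). x \<in> A \<and> y \<in> A \<and> {x, y} \<in> tree_edges}"
  have up: "(tree_parent ^^ k) u \<in> A \<and> (u, (tree_parent ^^ k) u) \<in> R\<^sup>*" if "u \<in> A" for u k
  proof (induction k)
    case (Suc k)
    let ?w = "(tree_parent ^^ k) u"
    have w: "?w \<in> A" "(u, ?w) \<in> R\<^sup>*" using Suc by auto
    then have "tree_parent ?w \<in> A"
      using closed by (auto simp: A_def descendant_closed_def in_tree_verts_iff)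
    moreover have "{?w, tree_parent ?w} \<in> tree_edges"
      using w(1) unfolding A_def tree_edges_def by blast
    ultimately have "(?w, tree_parent ?w) \<in> R"
      using w(1) by (simp add: R_def)
    with w(2) \<open>tree_parent ?w \<in> A\<close> show ?case
      by (auto intro: rtrancl_into_rtrancl)
  qed (use that in simp)
  have "sym R"
    by (auto simp: sym_def R_def insert_commute)
  have top: "(u, (N, 0)) \<in> R\<^sup>*" if "u \<in> A" "fst u + snd u \<le> N" for u N
  proof -
    obtain i j where u: "u = (i, j)" by (cases u)
    \<comment> \<open>N - i \<ge> j halvings bring the position j down to 0.\<close>
    have "j < 2 ^ j" by (rule less_exp)
    also have "(2::nat) ^ j \<le> 2 ^ (N - i)"
      using that(2) u by (intro power_increasing) auto
    finally have "(tree_parent ^^ (N - i)) u = (N, 0)"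
      using that(2) u by (simp add: tree_parent_funpow)
    then show ?thesis using up[OF that(1)] by metis
  qed
  have "(u, v) \<in> R\<^sup>*" if "u \<in> A" "v \<in> A" for u v
  proof -
    define N where "N = fst u + snd u + (fst v + snd v)"
    have "(u, (N, 0)) \<in> R\<^sup>*" "(v, (N, 0)) \<in> R\<^sup>*"
      using top that by (auto simp: N_def)
    then show ?thesis
      using sym_rtrancl[OF \<open>sym R\<close>] by (meson symD rtrancl_trans)
  qed
  moreover have "A \<noteq> {}"
    using exists_high_vertex[OF fin, of 0] unfolding A_def by blast
  ultimately show ?thesis
    unfolding induces_connected_def A_def[symmetric] R_def[symmetric] by blast
qed

section \<open>Boundary and leaves\<close>

definition tree_leaves :: "(nat \<times> nat) set \<Rightarrow> (nat \<times> nat) set" where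
  "tree_leaves S = {v \<in> S. fst v = 1}"

text \<open>Every non-leaf of \<open>S\<close> has exactly two children, both in \<open>S\<close> by
  closure, and these are all the members with a parent in \<open>S\<close>.\<close>

lemma card_parent_in_closed:
  assumes fin: "finite S" and sub: "S \<subseteq> tree_verts" and closed: "descendant_closed S"
  shows "card {v \<in> S. tree_parent v \<in> S} + 2 * card (tree_leaves S) = 2 * card S"
proof -
  define U where "U = S - tree_leaves S"
  \<comment> \<open>\<open>f\<close> and \<open>g\<close> give the left and right child; on
    \<open>U\<close> the level is at least 2, so the truncated subtraction is harmless.\<close>
  define f where "f = (\<lambda>(i::nat, j::nat). (i - 1, 2 * j))"
  define g where "g = (\<lambda>(i::nat, j::nat). (i - 1, Suc (2 * j)))"
  have U: "U = {v \<in> S. fst v \<ge> 2}"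
    using sub by (force simp: U_def tree_leaves_def in_tree_verts_iff)
  have parent: "tree_parent (f v) = v" "tree_parent (g v) = v" if "v \<in> U" for v
    using that by (auto simp: U f_def g_def tree_parent_def split: prod.splits)
  have verts: "f v \<in> tree_verts" "g v \<in> tree_verts" if "v \<in> U" for v
    using that by (auto simp: U f_def g_def in_tree_verts_iff split: prod.splits)
  have "{v \<in> S. tree_parent v \<in> S} = f ` U \<union> g ` U"
  proof
    show "f ` U \<union> g ` U \<subseteq> {v \<in> S. tree_parent v \<in> S}"
      using closed parent verts by (auto simp: descendant_closed_def U)
    show "{v \<in> S. tree_parent v \<in> S} \<subseteq> f ` U \<union> g ` U"
    proof
      fix v assume v: "v \<in> {v \<in> S. tree_parent v \<in> S}"
      then have "tree_parent v \<in> U"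
        using sub by (force simp: U in_tree_verts_iff)
      moreover have "v = f (tree_parent v) \<or> v = g (tree_parent v)"
        by (cases v) (auto simp: f_def g_def tree_parent_def)
      ultimately show "v \<in> f ` U \<union> g ` U" by blast
    qed
  qed
  moreover have "f ` U \<inter> g ` U = {}"
    by (auto simp: f_def g_def) presburger+
  moreover have "inj_on f U" "inj_on g U"
    using parent by (metis inj_on_inverseI)+
  moreover have "finite U" using fin by (simp add: U_def)
  ultimately have "card {v \<in> S. tree_parent v \<in> S} = 2 * card U"
    by (simp add: card_Un_disjoint card_image)
  moreover have "card U + card (tree_leaves S) = card S"
    using fin card_mono[of S "tree_leaves S"]
    by (auto simp: U_def tree_leaves_def card_Diff_subset)
  ultimately show ?thesis by simp
qed

text \<open>Closure forces every boundary edge to lead upwards out of \<open>S\<close>, so these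
  edges correspond to the members whose parent is outside.\<close>

lemma card_edge_boundary_closed:
  assumes fin: "finite S" and sub: "S \<subseteq> tree_verts" and closed: "descendant_closed S"
  shows "card (edge_boundary tree_verts tree_edges S) + card S = 2 * card (tree_leaves S)"
proof -
  let ?B = "{v \<in> S. tree_parent v \<notin> S}" and ?e = "\<lambda>v. {v, tree_parent v}"
  have "edge_boundary tree_verts tree_edges S = ?e ` ?B"
  proof
    show "?e ` ?B \<subseteq> edge_boundary tree_verts tree_edges S"
      using sub by (fastforce simp: edge_boundary_def tree_edges_def in_tree_verts_iff)
    show "edge_boundary tree_verts tree_edges S \<subseteq> ?e ` ?B"
    proof
      fix e assume "e \<in> edge_boundary tree_verts tree_edges S"
      then obtain v x y where v: "v \<in> tree_verts" "e = {v, tree_parent v}"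
        and xy: "x \<in> S" "y \<notin> S" "e = {x, y}"
        by (auto simp: edge_boundary_def tree_edges_def)
      have "v \<in> S \<and> tree_parent v \<notin> S"
        using closed v xy by (auto simp: descendant_closed_def doubleton_eq_iff)
      then show "e \<in> ?e ` ?B" using v(2) by blast
    qed
  qed
  \<comment> \<open>An edge determines its lower end: otherwise v would be its own
    grandparent.\<close>
  moreover have "inj ?e"
  proof (rule injI)
    fix v w assume eq: "?e v = ?e w"
    show "v = w"
    proof (rule ccontr)
      assume "v \<noteq> w"
      then have "v = tree_parent w" "tree_parent v = w"
        using eq by (auto simp: doubleton_eq_iff)
      then have "fst v = Suc (Suc (fst v))" by (metis fst_tree_parent)
      then show False by simp
    qed
  qed
  ultimately have "card (edge_boundary tree_verts tree_edges S) = card ?B"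
    by (metis (no_types, lifting) card_image inj_on_subset subset_UNIV)
  moreover have "card {v \<in> S. tree_parent v \<in> S} + card ?B = card S"
    using fin by (subst card_Un_disjoint[symmetric]) (auto intro: arg_cong[where f = card])
  ultimately show ?thesis
    using card_parent_in_closed[OF assms] by simp
qed

section \<open>Extremal sizes for a given number of leaves\<close>

text \<open>Induction on the height: delete the leaves and lower the rest by one level. The result
  \<open>S'\<close> is again closed and has at most half as many leaves, matching the recursion of
  \<open>forest_size\<close>.\<close>

lemma card_closed_le_forest_size:
  "\<lbrakk>finite S; S \<subseteq> tree_verts; descendant_closed S; \<And>v. v \<in> S \<Longrightarrow> fst v \<le> h\<rbrakk>
    \<Longrightarrow> card S \<le> forest_size (card (tree_leaves S))"
proof (induction h arbitrary: S)
  case 0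
  then have "S = {}" by (force simp: in_tree_verts_iff)
  then show ?case by simp
next
  case (Suc h)
  define up where "up = (\<lambda>(i::nat, j::nat). (Suc i, j))"
  have inj: "inj up" by (auto simp: up_def inj_def)
  define S' where "S' = {v \<in> tree_verts. up v \<in> S}"
  have up_S': "up ` S' = S - tree_leaves S"
  proof
    show "up ` S' \<subseteq> S - tree_leaves S"
      by (auto simp: S'_def up_def tree_leaves_def in_tree_verts_iff)
    show "S - tree_leaves S \<subseteq> up ` S'"
    proof
      fix v assume v: "v \<in> S - tree_leaves S"
      then have "fst v \<ge> 2"
        using Suc.prems(2) by (force simp: tree_leaves_def in_tree_verts_iff)
      then have "v = up (fst v - 1, snd v)" "(fst v - 1, snd v) \<in> tree_verts"
        by (auto simp: up_def in_tree_verts_iff)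
      then show "v \<in> up ` S'" using v by (force simp: S'_def)
    qed
  qed
  have fin': "finite S'"
    using up_S' Suc.prems(1) inj by (metis finite_Diff finite_imageD inj_on_subset subset_UNIV)
  have card_S: "card S = card (tree_leaves S) + card S'"
  proof -
    have "card S' = card (S - tree_leaves S)"
      using inj by (metis up_S' card_image inj_on_subset subset_UNIV)
    then show ?thesis
      using Suc.prems(1) card_mono[of S "tree_leaves S"]
      by (auto simp: tree_leaves_def card_Diff_subset)
  qed
  have closed': "descendant_closed S'"
    unfolding descendant_closed_def
  proof (intro ballI impI)
    fix v assume v: "v \<in> tree_verts" "tree_parent v \<in> S'"
    have "tree_parent (up v) = up (tree_parent v)"
      by (cases v) (simp add: up_def tree_parent_def)
    then have "up v \<in> S"
      using Suc.prems(3) v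
      by (cases v) (auto simp: S'_def descendant_closed_def in_tree_verts_iff up_def)
    then show "v \<in> S'" using v(1) by (simp add: S'_def)
  qed
  have "card S' \<le> forest_size (card (tree_leaves S'))"
  proof (rule Suc.IH[OF fin' _ closed'])
    show "S' \<subseteq> tree_verts" by (auto simp: S'_def)
    show "fst v \<le> h" if "v \<in> S'" for v
      using that Suc.prems(4)[of "up v"] by (cases v) (auto simp: S'_def up_def)
  qed
  moreover have "2 * card (tree_leaves S') \<le> card (tree_leaves S)"
  proof -
    \<comment> \<open>A leaf (1, j) of \<open>S'\<close> stands for (2, j) in \<open>S\<close>,
      whose children are the leaves (1, 2 j) and (1, 2 j + 1) of \<open>S\<close>.\<close>
    define f where "f = (\<lambda>(i::nat, j::nat). (1::nat, 2 * j))"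
    define g where "g = (\<lambda>(i::nat, j::nat). (1::nat, Suc (2 * j)))"
    let ?L = "tree_leaves S'"
    have "f ` ?L \<union> g ` ?L \<subseteq> tree_leaves S"
    proof -
      have "f v \<in> S \<and> g v \<in> S" if "v \<in> ?L" for v
      proof -
        have "tree_parent (f v) = up v" "tree_parent (g v) = up v" "up v \<in> S"
          using that by (auto simp: f_def g_def up_def tree_parent_def tree_leaves_def S'_def
              split: prod.splits)
        moreover have "f v \<in> tree_verts" "g v \<in> tree_verts"
          by (auto simp: f_def g_def in_tree_verts_iff split: prod.split)
        ultimately show ?thesis
          using Suc.prems(3) by (simp add: descendant_closed_def)
      qed
      then show ?thesis
        by (auto simp: tree_leaves_def) (auto simp: f_def g_def)
    qed
    moreover have "finite (tree_leaves S)" "finite ?L"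
      using Suc.prems(1) fin' by (auto simp: tree_leaves_def)
    moreover have "f ` ?L \<inter> g ` ?L = {}"
      by (auto simp: f_def g_def) presburger+
    moreover have "inj_on f ?L" "inj_on g ?L"
      by (auto simp: f_def g_def inj_on_def tree_leaves_def)
    ultimately show ?thesis
      using card_mono[of "tree_leaves S" "f ` ?L \<union> g ` ?L"]
      by (simp add: card_Un_disjoint card_image)
  qed
  then have "forest_size (card (tree_leaves S')) \<le> forest_size (card (tree_leaves S) div 2)"
    by (intro forest_size_mono) simp
  ultimately show ?case
    using card_S forest_size_rec[of "card (tree_leaves S)"] by simp
qed

text \<open>Confining the leaves to the first \<open>m\<close> positions makes the induction go through: a set built
  for \<open>m div 2\<close>, raised by one level, has all its children among the first \<open>m\<close> leaves.\<close>

lemma exists_closed: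
  "n \<le> forest_size m \<Longrightarrow>
    \<exists>S. finite S \<and> S \<subseteq> tree_verts \<and> descendant_closed S \<and> card S = n \<and>
      tree_leaves S \<subseteq> {1} \<times> {..<m}"
proof (induction m arbitrary: n rule: less_induct)
  case (less m)
  show ?case
  proof (cases m)
    case 0
    then show ?thesis
      using less.prems by (intro exI[of _ "{}"]) (auto simp: descendant_closed_def tree_leaves_def)
  next
    case (Suc p)
    show ?thesis
    proof (cases "n \<le> forest_size p")
      case True
      then show ?thesis using less.IH[of p n] Suc by fastforce
    next
      case False
      \<comment> \<open>There are enough vertices to fill all m leaf positions; the remaining n - m
        go on the levels above.\<close>
      then have nm: "m \<le> n" using forest_size_ge[of p] Suc by simp
      have le: "n - m \<le> forest_size (m div 2)"
        using less.prems forest_size_rec[of m] by simp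
      have "m div 2 < m" using Suc by simp
      from less.IH[OF this le] obtain S where S: "finite S" "S \<subseteq> tree_verts" "descendant_closed S"
        "card S = n - m" "tree_leaves S \<subseteq> {1} \<times> {..<m div 2}"
        by (elim exE conjE)
      define up where "up = (\<lambda>(i::nat, j::nat). (Suc i, j))"
      define S' where "S' = {1} \<times> {..<m} \<union> up ` S"
      have "inj up" by (auto simp: up_def inj_def)
      have "({1} \<times> {..<m}) \<inter> up ` S = {}"
        using S(2) by (auto simp: up_def in_tree_verts_iff)
      then have "card S' = n"
        using S(1,4) nm card_image[OF inj_on_subset[OF \<open>inj up\<close> subset_UNIV]]
        by (simp add: S'_def card_Un_disjoint)
      moreover have "finite S'" "S' \<subseteq> tree_verts"
        using S(1) by (auto simp: S'_def up_def in_tree_verts_iff)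
      moreover have "tree_leaves S' \<subseteq> {1} \<times> {..<m}"
        using S(2) by (auto simp: S'_def up_def tree_leaves_def in_tree_verts_iff)
      moreover have "descendant_closed S'"
        unfolding descendant_closed_def
      proof (intro ballI impI)
        fix v assume v: "v \<in> tree_verts" "tree_parent v \<in> S'"
        obtain i j where ij: "v = (i, j)" by (cases v)
        have S_ij: "(i, j div 2) \<in> S" and i: "i \<ge> 1"
          using v ij by (auto simp: S'_def up_def tree_parent_def in_tree_verts_iff)
        show "v \<in> S'"
        proof (cases "i = 1")
          case True
          then have "j div 2 < m div 2"
            using S(5) S_ij by (auto simp: tree_leaves_def)
          then show ?thesis using True ij by (auto simp: S'_def)
        next
          case False
          then have "tree_parent (i - 1, j) \<in> S" "(i - 1, j) \<in> tree_verts"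
            using S_ij i by (auto simp: tree_parent_def in_tree_verts_iff)
          then have "(i - 1, j) \<in> S" using S(3) by (simp add: descendant_closed_def)
          then have "up (i - 1, j) \<in> S'" by (simp add: S'_def)
          then show ?thesis using False i ij by (simp add: up_def)
        qed
      qed
      ultimately show ?thesis by blast
    qed
  qed
qed

section \<open>The minimum boundary\<close>

lemma conolly_le_card_leaves:
  assumes "finite S" "S \<subseteq> tree_verts" "descendant_closed S" "card S \<ge> 1"
  shows "conolly (card S) \<le> card (tree_leaves S)"
proof -
  obtain h where "\<And>v. v \<in> S \<Longrightarrow> fst v \<le> h"
    using assms(1) finite_nat_set_iff_bounded_le[of "fst ` S"] by auto
  then show ?thesis
    using card_closed_le_forest_size[OF assms(1-3)] conolly_le_iff[OF assms(4)] by blast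
qed

theorem theorem3p8:
  fixes n :: nat
  assumes "n \<ge> 1"
  shows "int (delta_P n) = 2 * int (conolly n) - int n"
proof -
  have "n \<le> forest_size (conolly n)"
    using conolly_le_iff[OF assms] by blast
  from exists_closed[OF this]
  obtain S where S: "finite S" "S \<subseteq> tree_verts" "descendant_closed S" "card S = n"
    "tree_leaves S \<subseteq> {1} \<times> {..<conolly n}"
    by (elim exE conjE)
  have "card (tree_leaves S) \<le> conolly n"
    using card_mono[OF _ S(5)] by (simp add: card_cartesian_product)
  \<comment> \<open>The construction gives at most \<open>conolly n\<close> leaves, the size bound
    at least as many.\<close>
  then have leaves: "card (tree_leaves S) = conolly n"
    using conolly_le_card_leaves[OF S(1-3)] S(4) assms by simp
  let ?b = "\<lambda>S. card (edge_boundary tree_verts tree_edges S)"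
  have "delta_P n = ?b S"
    unfolding delta_P_def
  proof (rule cInf_eq_minimum)
    show "?b S \<in> {?b S | S. S \<subseteq> tree_verts \<and> finite S \<and> card S = n \<and>
        induces_connected tree_edges (tree_verts - S)}"
      using S connected_if_descendant_closed by blast
    fix x assume "x \<in> {?b S | S. S \<subseteq> tree_verts \<and> finite S \<and> card S = n \<and>
        induces_connected tree_edges (tree_verts - S)}"
    then obtain R where R: "x = ?b R" "R \<subseteq> tree_verts" "finite R" "card R = n"
      "descendant_closed R"
      using descendant_closed_if_connected by blast
    \<comment> \<open>Both sets have n vertices, so their boundaries compare as their leaf counts
      do, and \<open>S\<close> has the fewest leaves.\<close>
    then show "?b S \<le> x"
      using card_edge_boundary_closed[OF R(3,2,5)] card_edge_boundary_closed[OF S(1-3)]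
        conolly_le_card_leaves[OF R(3,2,5)] R(1,4) S(4) leaves assms by simp
  qed
  then show ?thesis
    using card_edge_boundary_closed[OF S(1-3)] S(4) leaves by simp
qed

end
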